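(* For every odd integer $n\ge 3$, the cycle $C_n$ on $n$ vertices satisfies \[ \underline{\mathrm{lcs}}(C_n)=\begin{cases}\dfrac{n+3}{2} & \text{if } n\equiv 1 \pmod 4,\\[2mm] \dfrac{n+1}{2} & \text{if } n\equiv 3 \pmod 4.\end{cases} \]
   Context: $[k]=\{1,\dots,k\}$ and $\chi(G)$ is the chromatic number of a graph $G=(V,E)$. For a proper coloring $c:V\to[\chi(G)]$, a determining set for $(G,c)$ is a set $S\subseteq V$ such that for every proper coloring $c':V\to[\chi(G)]$ of $G$, if $c'|_S=c|_S$ then $c'=c$ on all of $V$. A critical set for $(G,c)$ is a determining set for $(G,c)$ that is minimal under inclusion. Define $\mathrm{lcs}(G,c)=\max\{|X| : X \text{ is a critical set for } (G,c)\}$ and $\underline{\mathrm{lcs}}(G)=\min_c \mathrm{lcs}(G,c)$, where the minimum is over all proper colorings $c:V\to[\chi(G)]$. *)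

theory Defs
  imports Complex_Main "HOL-Library.FuncSet"
begin

record 'a graph =
  verts :: "'a set"
  edges :: "'a set set"

definition finite_simple_graph :: "'a graph \<Rightarrow> bool" where
  "finite_simple_graph G \<longleftrightarrow>
     finite (verts G) \<and> (\<forall>e \<in> edges G. e \<subseteq> verts G \<and> card e = 2)"

text \<open>A colouring with colour set [k] is an extensional function on the vertex set, so two
  colourings are equal as functions iff they agree on all vertices.\<close>

definition proper_colorings :: "'a graph \<Rightarrow> nat \<Rightarrow> ('a \<Rightarrow> nat) set" where
  "proper_colorings G k =
     {c \<in> verts G \<rightarrow>\<^sub>E {1..k}. \<forall>u v. {u, v} \<in> edges G \<longrightarrow> c u \<noteq> c v}"

definition chromatic_number :: "'a graph \<Rightarrow> nat" where
  "chromatic_number G = (LEAST k. proper_colorings G k \<noteq> {})"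

abbreviation min_colorings :: "'a graph \<Rightarrow> ('a \<Rightarrow> nat) set" where
  "min_colorings G \<equiv> proper_colorings G (chromatic_number G)"

definition determining_set :: "'a graph \<Rightarrow> ('a \<Rightarrow> nat) \<Rightarrow> 'a set \<Rightarrow> bool" where
  "determining_set G c S \<longleftrightarrow>
     S \<subseteq> verts G \<and>
     (\<forall>c' \<in> min_colorings G. (\<forall>v \<in> S. c' v = c v) \<longrightarrow> (\<forall>v \<in> verts G. c' v = c v))"

definition critical_set :: "'a graph \<Rightarrow> ('a \<Rightarrow> nat) \<Rightarrow> 'a set \<Rightarrow> bool" where
  "critical_set G c S \<longleftrightarrow>
     determining_set G c S \<and> (\<forall>T. T \<subset> S \<longrightarrow> \<not> determining_set G c T)"

definition lcs :: "'a graph \<Rightarrow> ('a \<Rightarrow> nat) \<Rightarrow> nat" where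
  "lcs G c = Max {card X | X. critical_set G c X}"

definition lcs_lower :: "'a graph \<Rightarrow> nat" where
  "lcs_lower G = Min {lcs G c | c. c \<in> min_colorings G}"

text \<open>The cycle has its intended meaning only for n at least 3.\<close>

definition cycle_graph :: "nat \<Rightarrow> nat graph" where
  "cycle_graph n = \<lparr>verts = {..<n}, edges = {{i, (i + 1) mod n} | i. i < n}\<rparr>"

lemma finite_simple_graph_cycle_graph:
  assumes "n \<ge> 3"
  shows "finite_simple_graph (cycle_graph n)"
proof -
  have "card {i, (i + 1) mod n} = 2" if "i < n" for i
  proof -
    have "(i + 1) mod n \<noteq> i"
      using that assms by (cases "i + 1 = n") auto
    then show ?thesis by simp
  qed
  then show ?thesis
    using assms by (auto simp: finite_simple_graph_def cycle_graph_def)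
qed

text \<open>The following facts show that, for finite simple graphs, the minimum in the chromatic
  number, the maximum in lcs and the minimum in its lower version range over nonempty
  (and, for Max and Min, finite) sets.\<close>

lemma min_colorings_nonempty:
  assumes "finite_simple_graph G"
  shows "min_colorings G \<noteq> {}"
proof -
  have fin: "finite (verts G)"
    using assms by (simp add: finite_simple_graph_def)
  obtain f where f: "bij_betw f (verts G) {1..card (verts G)}"
    using ex_bij_betw_finite_nat[OF fin] finite_same_card_bij[OF fin, of "{1..card (verts G)}"]
    by auto
  have "restrict f (verts G) \<in> proper_colorings G (card (verts G))"
  proof -
    have "restrict f (verts G) u \<noteq> restrict f (verts G) v" if e: "{u, v} \<in> edges G" for u v
    proof -
      have "u \<in> verts G" "v \<in> verts G" "card {u, v} = 2"
        using assms e unfolding finite_simple_graph_def by blast+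
      moreover from this have "u \<noteq> v" by auto
      ultimately show ?thesis
        using f by (auto simp: bij_betw_def inj_on_def)
    qed
    moreover have "restrict f (verts G) \<in> verts G \<rightarrow>\<^sub>E {1..card (verts G)}"
      using f by (auto simp: bij_betw_def)
    ultimately show ?thesis by (simp add: proper_colorings_def)
  qed
  then have "proper_colorings G (card (verts G)) \<noteq> {}" by blast
  then show ?thesis
    unfolding chromatic_number_def by (rule LeastI)
qed

lemma finite_proper_colorings:
  assumes "finite (verts G)"
  shows "finite (proper_colorings G k)"
  unfolding proper_colorings_def using assms by (simp add: finite_PiE)

lemma finite_critical_cards:
  assumes "finite (verts G)"
  shows "finite {card X | X. critical_set G c X}"
proof -
  have "{card X | X. critical_set G c X} \<subseteq> card ` Pow (verts G)"
    by (auto simp: critical_set_def determining_set_def)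
  then show ?thesis
    using assms by (meson finite_Pow_iff finite_imageI finite_subset)
qed

lemma critical_set_exists:
  assumes "finite (verts G)"
  shows "\<exists>X. critical_set G c X"
proof -
  have "finite {S. determining_set G c S}"
    by (rule finite_subset[of _ "Pow (verts G)"]) (auto simp: determining_set_def assms)
  moreover have "{S. determining_set G c S} \<noteq> {}"
    by (auto simp: determining_set_def)
  ultimately obtain m where "m \<in> {S. determining_set G c S}"
      "\<forall>T \<in> {S. determining_set G c S}. T \<subseteq> m \<longrightarrow> m = T"
    using finite_has_minimal by metis
  then show ?thesis
    unfolding critical_set_def by auto
qed

end

theory Submission
  imports Defs
begin

text \<open>With three colours, a vertex set determines the colouring iff its complement \<open>I\<close> is independent
  and every vertex of \<open>I\<close> has neighbours of different colours; critical sets are the complements of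
  the maximal such \<open>I\<close>. Put \<open>n = 2 * m + 1\<close>. Independence gives \<open>card I \<le> m\<close>, hence
  \<open>lcs \<ge> m + 1\<close>. If \<open>m\<close> is even and \<open>card I = m\<close>, then after a rotation \<open>I = {2, 4, \<dots>, 2 * m}\<close>;
  the colours at the odd vertices together with vertex 0 properly colour an odd cycle, so they
  cannot alternate, and where they fail to, two consecutive elements of \<open>I\<close> can be replaced by the
  vertex between them. The result is maximal of size \<open>m - 1\<close>, hence \<open>lcs \<ge> m + 2\<close>. Explicit
  colourings show that both bounds are attained.\<close>

section \<open>Cyclic indices, three colours and colourings of the cycle\<close>

lemma Suc_mod_cancel: "Suc i mod n = Suc p mod n \<longleftrightarrow> i mod n = p mod (n::nat)"
proof
  assume "Suc i mod n = Suc p mod n"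
  \<comment> \<open>Adding n - 1 undoes the successor modulo n. For n = 0 the reduction is the
    identity, which the case split below absorbs.\<close>
  then have "(Suc i + (n - 1)) mod n = (Suc p + (n - 1)) mod n"
    by (metis mod_add_left_eq)
  then show "i mod n = p mod n"
    by (cases "n = 0") (auto simp: \<open>Suc i mod n = Suc p mod n\<close>)
next
  assume "i mod n = p mod n"
  then show "Suc i mod n = Suc p mod n" by (metis mod_Suc_eq)
qed

lemma Suc_mod_neq: "n \<ge> 2 \<Longrightarrow> Suc i mod n \<noteq> i mod (n::nat)"
  by (simp add: mod_Suc)

lemma Suc_Suc_mod_neq: "n \<ge> 3 \<Longrightarrow> Suc (Suc i) mod n \<noteq> i mod (n::nat)"
  by (auto simp: mod_Suc)

lemma pred_mod_exists: "i < n \<Longrightarrow> \<exists>p. i = Suc p mod (n::nat)"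
  \<comment> \<open>Adding n first avoids truncated subtraction at i = 0.\<close>
  by (rule exI[of _ "i + n - 1"]) auto

lemma third_colour:
  fixes w x y z :: nat
  assumes "w \<in> {1..3}" "x \<in> {1..3}" "y \<in> {1..3}" "z \<in> {1..3}"
    and "x \<noteq> y" "w \<noteq> x" "w \<noteq> y" "z \<noteq> x" "z \<noteq> y"
  shows "w = z"
  using assms by auto

lemma third_colour_exists:
  fixes x y :: nat
  shows "\<exists>z \<in> {1..3}. z \<noteq> x \<and> z \<noteq> y"
proof -
  have "\<exists>z. (z = 1 \<or> z = 2 \<or> z = (3::nat)) \<and> z \<noteq> x \<and> z \<noteq> y" by presburger
  then show ?thesis by auto
qed

lemma verts_cycle [simp]: "verts (cycle_graph n) = {..<n}"
  by (simp add: cycle_graph_def)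

lemma proper_colorings_cycle:
  assumes "n > 0"
  shows "c \<in> proper_colorings (cycle_graph n) k \<longleftrightarrow>
    c \<in> {..<n} \<rightarrow>\<^sub>E {1..k} \<and> (\<forall>i. c (i mod n) \<noteq> c (Suc i mod n))"
proof -
  have "(\<forall>u v. {u, v} \<in> edges (cycle_graph n) \<longrightarrow> c u \<noteq> c v) \<longleftrightarrow>
      (\<forall>i. c (i mod n) \<noteq> c (Suc i mod n))" (is "?l \<longleftrightarrow> ?r")
  proof
    assume l: ?l
    show ?r
    proof
      fix i
      have "{i mod n, Suc i mod n} \<in> edges (cycle_graph n)"
        using assms mod_Suc_eq[of i n] unfolding cycle_graph_def
        by (simp, metis mod_less_divisor)
      then show "c (i mod n) \<noteq> c (Suc i mod n)" using l by blast
    qed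
  next
    assume r: ?r
    show ?l
    proof (intro allI impI)
      fix u v assume "{u, v} \<in> edges (cycle_graph n)"
      then obtain i where "i < n" "{u, v} = {i, Suc i mod n}"
        by (auto simp: cycle_graph_def)
      then show "c u \<noteq> c v"
        using r[rule_format, of i] by (auto simp: doubleton_eq_iff)
    qed
  qed
  then show ?thesis by (simp add: proper_colorings_def)
qed

section \<open>Critical sets as complements of maximal removable sets\<close>

text \<open>Cyclic positions are written \<open>i mod n\<close> for an arbitrary natural number \<open>i\<close>, which makes
  the predecessor of a vertex expressible without subtraction.\<close>

definition removable :: "nat \<Rightarrow> (nat \<Rightarrow> nat) \<Rightarrow> nat set \<Rightarrow> bool" where
  "removable n c I \<longleftrightarrow> I \<subseteq> {..<n} \<and>
     (\<forall>i. i mod n \<in> I \<longrightarrow> Suc i mod n \<notin> I) \<and>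
     (\<forall>i. Suc i mod n \<in> I \<longrightarrow> c (i mod n) \<noteq> c (Suc (Suc i) mod n))"

definition maximal_removable :: "nat \<Rightarrow> (nat \<Rightarrow> nat) \<Rightarrow> nat set \<Rightarrow> bool" where
  "maximal_removable n c I \<longleftrightarrow> removable n c I \<and>
     (\<forall>v<n. v \<notin> I \<longrightarrow> \<not> removable n c (insert v I))"

lemma removableD:
  assumes "removable n c I"
  shows "i mod n \<in> I \<Longrightarrow> Suc i mod n \<notin> I"
    and "Suc i mod n \<in> I \<Longrightarrow> c (i mod n) \<noteq> c (Suc (Suc i) mod n)"
  using assms unfolding removable_def by blast+

lemma removable_subset: "removable n c I \<Longrightarrow> J \<subseteq> I \<Longrightarrow> removable n c J"
  unfolding removable_def by (meson subsetD subset_trans)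

text \<open>A vertex outside \<open>S\<close> that sees only one colour can be recoloured, and once
  this is excluded, two adjacent vertices outside \<open>S\<close> can exchange their colours.
  Conversely, a removable vertex has both neighbours in \<open>S\<close>, and their two different
  colours leave only the third for it.\<close>

lemma determining_iff_removable:
  assumes n: "n \<ge> 3" and chi: "chromatic_number (cycle_graph n) = 3"
    and c: "c \<in> proper_colorings (cycle_graph n) 3"
  shows "determining_set (cycle_graph n) c S \<longleftrightarrow> S \<subseteq> {..<n} \<and> removable n c ({..<n} - S)"
proof
  have pos: "0 < n" using n by simp
  note pc = proper_colorings_cycle[OF pos]
  have ran: "c (i mod n) \<in> {1..3}" for i using c pos by (auto simp: pc PiE_iff)
  have ne: "c (i mod n) \<noteq> c (Suc i mod n)" for i using c by (simp add: pc)
  {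
    assume det: "determining_set (cycle_graph n) c S"
    have S: "S \<subseteq> {..<n}" using det by (simp add: determining_set_def)
    have eq: "c' v = c v" if "c' \<in> proper_colorings (cycle_graph n) 3" "\<forall>v\<in>S. c' v = c v" "v < n" for c' v
      using det that unfolding determining_set_def chi verts_cycle by blast
    have good: "c (p mod n) \<noteq> c (Suc (Suc p) mod n)" if q: "Suc p mod n \<notin> S" for p
    proof
      assume e: "c (p mod n) = c (Suc (Suc p) mod n)"
      obtain x where x: "x \<in> {1..3}" "x \<noteq> c (p mod n)" "x \<noteq> c (Suc p mod n)"
        using third_colour_exists by blast
      let ?c = "c(Suc p mod n := x)"
      have "?c (i mod n) \<noteq> ?c (Suc i mod n)" for i
      proof -
        have "Suc i mod n = Suc (Suc p) mod n" if "i mod n = Suc p mod n"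
          using that by (simp add: Suc_mod_cancel)
        then show ?thesis
          using Suc_mod_neq[of n i] n x e ne[of i] Suc_mod_cancel[of i n p] by auto
      qed
      then have "?c \<in> proper_colorings (cycle_graph n) 3"
        using c x pos by (auto simp: pc PiE_iff extensional_def)
      then have "?c (Suc p mod n) = c (Suc p mod n)"
        by (rule eq) (use q pos in auto)
      then show False using x by simp
    qed
    have indep: False if q: "Suc p mod n \<notin> S" and r: "Suc (Suc p) mod n \<notin> S" for p
    proof -
      let ?x = "c (Suc p mod n)" and ?y = "c (Suc (Suc p) mod n)"
      let ?c = "c(Suc p mod n := ?y, Suc (Suc p) mod n := ?x)"
      have qr: "Suc p mod n \<noteq> Suc (Suc p) mod n" using Suc_mod_neq[of n "Suc p"] n by simp
      \<comment> \<open>\<open>good\<close> at the two vertices says exactly that neither swapped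
        colour clashes with the outer neighbour.\<close>
      have y: "c (p mod n) \<noteq> ?y" by (rule good[OF q])
      have x: "?x \<noteq> c (Suc (Suc (Suc p)) mod n)" by (rule good[OF r])
      have "?c (i mod n) \<noteq> ?c (Suc i mod n)" for i
      proof -
        consider "i mod n = p mod n" | "i mod n = Suc p mod n" | "i mod n = Suc (Suc p) mod n"
          | "i mod n \<noteq> p mod n" "i mod n \<noteq> Suc p mod n" "i mod n \<noteq> Suc (Suc p) mod n" by blast
        then show ?thesis
        proof cases
          case 1
          then have "Suc i mod n = Suc p mod n" by (simp add: Suc_mod_cancel)
          then show ?thesis using 1 y qr Suc_mod_neq[of n p] Suc_Suc_mod_neq[of n p] n by auto
        next
          case 2
          then have "Suc i mod n = Suc (Suc p) mod n" by (simp add: Suc_mod_cancel)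
          then show ?thesis using 2 qr ne[of "Suc p"] by auto
        next
          case 3
          then have "Suc i mod n = Suc (Suc (Suc p)) mod n" by (simp add: Suc_mod_cancel)
          then show ?thesis
            using 3 x Suc_mod_neq[of n "Suc (Suc p)"] Suc_Suc_mod_neq[of n "Suc p"] n by auto
        next
          case 4
          then show ?thesis using ne[of i] by (simp add: Suc_mod_cancel)
        qed
      qed
      then have "?c \<in> proper_colorings (cycle_graph n) 3"
        using c ran pos by (auto simp: pc PiE_iff extensional_def)
      then have "?c (Suc p mod n) = c (Suc p mod n)"
        by (rule eq) (use q r pos in auto)
      then show False using ne[of "Suc p"] qr by simp
    qed
    have "Suc i mod n \<in> S" if "i mod n \<notin> S" for i
    proof -
      obtain p where "i mod n = Suc p mod n" using pred_mod_exists[of "i mod n" n] pos by auto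
      then show ?thesis using indep[of p] that Suc_mod_cancel[of i n "Suc p"] by auto
    qed
    then show "S \<subseteq> {..<n} \<and> removable n c ({..<n} - S)"
      using S good pos by (auto simp: removable_def)
  next
    assume R: "S \<subseteq> {..<n} \<and> removable n c ({..<n} - S)"
    have "c' v = c v"
      if c': "c' \<in> proper_colorings (cycle_graph n) 3" and ag: "\<forall>v\<in>S. c' v = c v" and v: "v < n" for c' v
    proof (cases "v \<in> S")
      case False
      obtain p where p: "v = Suc p mod n" using pred_mod_exists[OF v] by blast
      have 1: "c (p mod n) \<noteq> c (Suc (Suc p) mod n)" "p mod n \<in> S" "Suc (Suc p) mod n \<in> S"
        using removableD(1)[of n c "{..<n} - S" p] removableD(1)[of n c "{..<n} - S" "Suc p"]
          removableD(2)[of n c "{..<n} - S" p] R False p pos by auto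
      have ran': "c' (i mod n) \<in> {1..3}" for i using c' pos by (auto simp: pc PiE_iff)
      have ne': "c' (i mod n) \<noteq> c' (Suc i mod n)" for i using c' by (simp add: pc)
      show ?thesis
        using third_colour[OF ran'[of "Suc p"] ran[of p] ran[of "Suc (Suc p)"] ran[of "Suc p"] 1(1)]
          ne[of p] ne[of "Suc p"] ne'[of p] ne'[of "Suc p"] ag 1 p by metis
    qed (use ag in simp)
    then show "determining_set (cycle_graph n) c S"
      using R unfolding determining_set_def chi verts_cycle by blast
  }
qed

text \<open>Removability passes to subsets, so the single insertions tested by
  \<open>maximal_removable\<close> already rule out every larger removable set.\<close>

lemma critical_iff_maximal_removable:
  assumes "n \<ge> 3" and "chromatic_number (cycle_graph n) = 3"
    and "c \<in> proper_colorings (cycle_graph n) 3"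
  shows "critical_set (cycle_graph n) c S \<longleftrightarrow> S \<subseteq> {..<n} \<and> maximal_removable n c ({..<n} - S)"
proof
  note det = determining_iff_removable[OF assms]
  {
    assume crit: "critical_set (cycle_graph n) c S"
    then have S: "S \<subseteq> {..<n}" "removable n c ({..<n} - S)"
      by (auto simp: critical_set_def det)
    have "\<not> removable n c (insert v ({..<n} - S))" if "v < n" "v \<in> S" for v
    proof -
      have "\<not> determining_set (cycle_graph n) c (S - {v})"
        using crit that by (auto simp: critical_set_def)
      moreover have "{..<n} - (S - {v}) = insert v ({..<n} - S)" using that by auto
      ultimately show ?thesis using S by (auto simp: det)
    qed
    then show "S \<subseteq> {..<n} \<and> maximal_removable n c ({..<n} - S)"
      using S by (auto simp: maximal_removable_def)
  next
    assume M: "S \<subseteq> {..<n} \<and> maximal_removable n c ({..<n} - S)"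
    have "\<not> determining_set (cycle_graph n) c T" if T: "T \<subset> S" for T
    proof
      assume "determining_set (cycle_graph n) c T"
      then have r: "removable n c ({..<n} - T)" by (simp add: det)
      obtain v where v: "v \<in> S" "v \<notin> T" using T by blast
      have "removable n c (insert v ({..<n} - S))"
        by (rule removable_subset[OF r]) (use v M T in auto)
      then show False using M v by (auto simp: maximal_removable_def)
    qed
    then show "critical_set (cycle_graph n) c S"
      using M by (auto simp: critical_set_def det maximal_removable_def)
  }
qed

section \<open>Rotations of the cycle\<close>

lemma rotate_back:
  assumes "a < (n::nat)"
  shows "((i + (n - a)) mod n + a) mod n = i mod n" "((i + a) mod n + (n - a)) mod n = i mod n"
  unfolding mod_add_left_eq using assms by simp_all

lemma bij_betw_rotate:
  assumes "a < (n::nat)" "I \<subseteq> {..<n}"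
  shows "bij_betw (\<lambda>k. (k + a) mod n) {k. k < n \<and> (k + a) mod n \<in> I} I"
proof (rule bij_betw_byWitness[where f' = "\<lambda>i. (i + (n - a)) mod n"])
  note rot = rotate_back[OF assms(1)]
  show "\<forall>k\<in>{k. k < n \<and> (k + a) mod n \<in> I}. ((k + a) mod n + (n - a)) mod n = k"
    by (simp only: rot) auto
  show "\<forall>i\<in>I. ((i + (n - a)) mod n + a) mod n = i"
    using assms(2) by (simp only: rot) auto
  have "((i + (n - a)) mod n + a) mod n \<in> I" if "i \<in> I" for i
    using assms(2) that by (simp only: rot) auto
  then show "(\<lambda>i. (i + (n - a)) mod n) ` I \<subseteq> {k. k < n \<and> (k + a) mod n \<in> I}"
    using assms(1) by auto
qed auto

lemma card_rotate:
  assumes "a < (n::nat)" "I \<subseteq> {..<n}"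
  shows "card {k. k < n \<and> (k + a) mod n \<in> I} = card I"
  using bij_betw_rotate[OF assms] by (rule bij_betw_same_card)

lemma removable_rotate:
  assumes "removable n c I" "0 < n"
  shows "removable n (\<lambda>i. c ((i + a) mod n)) {k. k < n \<and> (k + a) mod n \<in> I}"
proof -
  have [simp]: "(i mod n + a) mod n = (i + a) mod n" "(Suc i mod n + a) mod n = Suc (i + a) mod n"
    "(Suc (Suc i) mod n + a) mod n = Suc (Suc (i + a)) mod n" for i
    by (simp_all add: mod_add_left_eq)
  show ?thesis using assms by (auto simp: removable_def)
qed

lemma removable_rotate_iff:
  assumes "a < n" "I \<subseteq> {..<n}"
  shows "removable n (\<lambda>i. c ((i + a) mod n)) {k. k < n \<and> (k + a) mod n \<in> I} \<longleftrightarrow> removable n c I"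
    (is "removable n ?b ?K \<longleftrightarrow> _")
proof
  assume r: "removable n ?b ?K"
  note rot = rotate_back(1)[OF assms(1)]
  have K: "{i. i < n \<and> (i + (n - a)) mod n \<in> ?K} = I"
  proof -
    have "((i + (n - a)) mod n + a) mod n \<in> I \<longleftrightarrow> i \<in> I" if "i < n" for i
      using that by (simp only: rot) simp
    then show ?thesis using assms by auto
  qed
  \<comment> \<open>Rotating there and back yields c (i mod n) rather than \<open>c\<close> itself;
    \<open>removable\<close> reads colours only at reduced positions, so the difference is invisible
    to it.\<close>
  have "removable n (\<lambda>i. c (i mod n)) I"
    using removable_rotate[OF r, of "n - a"] assms(1) unfolding K rot by simp
  then show "removable n c I" by (simp add: removable_def)
next
  assume "removable n c I"
  then show "removable n ?b ?K" by (rule removable_rotate) (use assms in simp)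
qed

section \<open>Independent sets in the cycle\<close>

text \<open>By independence, \<open>I\<close> is disjoint from the set of predecessors of its
  elements, which has the same size.\<close>

lemma card_independent:
  assumes "n \<ge> 2" "I \<subseteq> {..<n}" "\<And>i. i mod n \<in> I \<Longrightarrow> Suc i mod n \<notin> I"
  shows "card (I \<union> {k. k < n \<and> (k + 1) mod n \<in> I}) = 2 * card I" "2 * card I \<le> n"
proof -
  let ?J = "{k. k < n \<and> (k + 1) mod n \<in> I}"
  have "I \<inter> ?J = {}"
  proof -
    have "Suc i mod n \<notin> I" if "i \<in> I" for i
      using assms(3)[of i] assms(2) that by auto
    then show ?thesis by auto
  qed
  moreover have "card ?J = card I" by (rule card_rotate) (use assms in auto)
  moreover have "finite I" using assms(2) finite_subset by blast
  ultimately show "card (I \<union> ?J) = 2 * card I" by (simp add: card_Un_disjoint)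
  moreover have "card (I \<union> ?J) \<le> card {..<n}" by (rule card_mono) (use assms in auto)
  ultimately show "2 * card I \<le> n" by simp
qed

text \<open>\<open>I\<close> and its predecessors fill all but one vertex \<open>a\<close>. Neither
  \<open>a\<close> nor its successor lies in \<open>I\<close>, and every other vertex has exactly
  one of itself and its successor in \<open>I\<close>, so membership alternates from
  \<open>a\<close> onwards.\<close>

lemma large_independent:
  assumes n: "n = 2 * m + 1" "m \<ge> 1" and I: "I \<subseteq> {..<n}" "card I = m"
    and ind: "\<And>i. i mod n \<in> I \<Longrightarrow> Suc i mod n \<notin> I"
  shows "\<exists>a<n. {k. k < n \<and> (k + a) mod n \<in> I} = {k. even k \<and> 0 < k \<and> k < n}"
proof -
  let ?U = "I \<union> {k. k < n \<and> (k + 1) mod n \<in> I}"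
  have U: "?U \<subseteq> {..<n}" using I by auto
  have "card ?U = 2 * m" using card_independent(1)[of n I] n I ind by simp
  then have "card ({..<n} - ?U) = 1"
    using U n by (subst card_Diff_subset) (auto intro: finite_subset)
  then obtain a where a: "{..<n} - ?U = {a}" by (auto simp: card_1_singleton_iff)
  have an: "a < n" "a \<notin> I" "Suc a mod n \<notin> I" using a by auto
  have cov: "i mod n \<in> I \<or> Suc i mod n \<in> I" if "i mod n \<noteq> a" for i
  proof -
    have "i mod n \<notin> {..<n} - ?U" unfolding a using that by simp
    then have "i mod n \<in> ?U" using n by simp
    then show ?thesis by (auto simp: mod_Suc_eq)
  qed
  have "(k + a) mod n \<in> I \<longleftrightarrow> even k \<and> 0 < k" if "k < n" for k
    using that
  proof (induction k)
    case 0
    then show ?case using an by simp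
  next
    case (Suc k)
    show ?case
    proof (cases "k = 0")
      case True
      then show ?thesis using an by simp
    next
      case False
      \<comment> \<open>The alternation fails only at \<open>a\<close>, and a walk of fewer than n
        steps does not return there.\<close>
      have "(k + a) mod n \<noteq> a"
      proof
        assume "(k + a) mod n = a"
        then have "(a + (n - a)) mod n = k mod n" using rotate_back(2)[OF an(1), of k] by simp
        then show False using an(1) Suc.prems False by simp
      qed
      then show ?thesis using cov[of "k + a"] ind[of "k + a"] Suc False by auto
    qed
  qed
  then show ?thesis using an by blast
qed

section \<open>The exchange argument for even m\<close>

lemma constant_on_parity:
  fixes y :: "nat \<Rightarrow> nat"
  assumes "\<And>i. i < k \<Longrightarrow> y (s + 2 * i) = y (s + 2 * i + 2)"
  shows "y (s + 2 * k) = y s"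
  using assms
proof (induction k)
  case (Suc k)
  then have "y (s + 2 * k) = y s" by simp
  then show ?case using Suc.prems[of k] by (simp add: algebra_simps)
qed simp

text \<open>Here \<open>y\<close> lists the colours seen at every second vertex; these form a proper colouring
  of the cycle of odd length \<open>m + 1\<close>. If no admissible \<open>j\<close> exists, then \<open>y\<close> is constant on the odd
  indices, this forces the two boundary conditions, and then \<open>y\<close> is constant on the even indices
  too, against \<open>y 0 \<noteq> y m\<close>.\<close>

lemma exchange_position:
  fixes y :: "nat \<Rightarrow> nat"
  assumes m: "even m" "m \<ge> 2" and ne: "\<And>i. i < m \<Longrightarrow> y i \<noteq> y (Suc i)" "y 0 \<noteq> y m"
  shows "\<exists>j. j + 2 \<le> m \<and> y j \<noteq> y (j + 2) \<and> (j = 0 \<longrightarrow> y 1 \<noteq> y m) \<and> (j + 2 = m \<longrightarrow> y 0 \<noteq> y (m - 1))"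
proof (rule ccontr)
  assume neg: "\<not> ?thesis"
  obtain q where q: "m = 2 * q" "q \<ge> 1" using m by (auto elim!: evenE)
  have "y (1 + 2 * (q - 1)) = y 1"
  proof (rule constant_on_parity)
    fix i assume "i < q - 1"
    \<comment> \<open>The index j = 2i + 1 is odd, hence neither 0 nor m - 2, and both boundary
      conditions are vacuous for it.\<close>
    then have "1 + 2 * i + 2 \<le> m" "1 + 2 * i + 2 \<noteq> m" using q by (simp, presburger)
    then show "y (1 + 2 * i) = y (1 + 2 * i + 2)" using neg by (metis add_is_0 one_neq_zero)
  qed
  moreover have "1 + 2 * (q - 1) = m - 1" using q by (cases q) auto
  ultimately have odd: "y (m - 1) = y 1" by simp
  have b: "y 1 \<noteq> y m" "y 0 \<noteq> y (m - 1)"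
    using odd ne(1)[of 0] ne(1)[of "m - 1"] m by auto
  have "y (0 + 2 * q) = y 0"
  proof (rule constant_on_parity)
    fix i assume "i < q"
    then have "0 + 2 * i + 2 \<le> m" using q by simp
    then show "y (0 + 2 * i) = y (0 + 2 * i + 2)" using neg b by blast
  qed
  then show False using ne q by simp
qed

text \<open>The new set arises by replacing 2j+2 and 2j+4 by 2j+3. The condition at j makes 2j+3
  removable; the two boundary conditions keep vertices 0 and 1 from becoming addable.\<close>

lemma exchange:
  fixes b :: "nat \<Rightarrow> nat"
  assumes n: "n = 2 * m + 1" and m: "even m" "m \<ge> 2"
    and per: "\<And>i. b (i mod n) = b i" and ran: "\<And>i. b i \<in> {1..3}" and ne: "\<And>i. b i \<noteq> b (Suc i)"
    and rem: "removable n b {k. even k \<and> 0 < k \<and> k < n}"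
  shows "\<exists>K. maximal_removable n b K \<and> card K = m - 1"
proof -
  let ?E = "{k. even k \<and> 0 < k \<and> k < n}"
  have bn: "b n = b 0" "b (Suc n) = b 1" using per[of n] per[of "Suc n"] n m by (simp_all add: mod_Suc)
  have ne': "b k \<noteq> b l" if "l = k + 1" for k l using ne[of k] that by simp
  have good: "b k \<noteq> b l" if "odd k" "k + 1 < n" "l = k + 2" for k l
    using rem that unfolding removable_def per by (auto dest: spec[of _ k])
  obtain j where j: "j + 2 \<le> m" "b (2 * j + 1) \<noteq> b (2 * j + 5)"
    "j = 0 \<Longrightarrow> b 3 \<noteq> b 0" "j + 2 = m \<Longrightarrow> b 1 \<noteq> b (2 * m - 1)"
  proof -
    \<comment> \<open>Here \<open>exchange_position\<close> is applied to y i = b (2i+1).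
      Consecutive values differ because 2i+2 in \<open>?E\<close> lies between them, and y m is the
      colour of vertex 0, since position 2m+1 is n.\<close>
    have "\<exists>j. j + 2 \<le> m \<and> b (2 * j + 1) \<noteq> b (2 * (j + 2) + 1) \<and> (j = 0 \<longrightarrow> b (2 * 1 + 1) \<noteq> b (2 * m + 1))
        \<and> (j + 2 = m \<longrightarrow> b (2 * 0 + 1) \<noteq> b (2 * (m - 1) + 1))"
    proof (rule exchange_position[OF m])
      fix i assume "i < m"
      then show "b (2 * i + 1) \<noteq> b (2 * Suc i + 1)" by (intro good) (use n in auto)
    next
      show "b (2 * 0 + 1) \<noteq> b (2 * m + 1)" using ne[of 0] bn n by auto
    qed
    moreover have "2 * (m - 1) + 1 = 2 * m - 1" using m by simp
    ultimately show ?thesis using that bn n by (auto simp: algebra_simps numeral_eq_Suc)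
  qed
  let ?K = "insert (2 * j + 3) (?E - {2 * j + 2, 2 * j + 4})"
  have cE: "card ?E = m"
  proof -
    have "?E = (\<lambda>i. 2 * i + 2) ` {..<m}"
    proof (intro subset_antisym subsetI)
      fix k assume "k \<in> ?E"
      then obtain i where "k = 2 * i" "0 < i" "2 * i < n" by (auto elim!: evenE)
      then show "k \<in> (\<lambda>i. 2 * i + 2) ` {..<m}" using n by (intro image_eqI[of _ _ "i - 1"]) auto
    qed (use n in auto)
    then show ?thesis by (simp add: card_image inj_on_def)
  qed
  have cK: "card ?K = m - 1"
  proof -
    have "card (?E - {2 * j + 2, 2 * j + 4}) = m - 2"
      using cE j n by (subst card_Diff_subset) auto
    then show ?thesis using m j by (subst card_insert_disjoint) auto
  qed
  \<comment> \<open>If 2j+2 and 2j+4 shared a colour, then 2j+1 and 2j+5 would both avoid it and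
    also avoid the different colour of 2j+3, hence would agree, against the choice of j.\<close>
  have mid: "b (2 * j + 2) \<noteq> b (2 * j + 4)"
  proof
    assume e: "b (2 * j + 2) = b (2 * j + 4)"
    have "b (2 * j + 3) \<noteq> b (2 * j + 5)" "b (2 * j + 1) \<noteq> b (2 * j + 3)"
      by (rule good; use j n in auto)+
    moreover have "b (2 * j + 2) \<noteq> b (2 * j + 3)" "b (2 * j + 1) \<noteq> b (2 * j + 2)" "b (2 * j + 4) \<noteq> b (2 * j + 5)"
      by (rule ne'; simp)+
    ultimately show False
      using third_colour[OF ran ran ran ran, of "2*j+1" "2*j+3" "2*j+2" "2*j+5"] e j by metis
  qed
  have memK: "k \<in> ?K \<longleftrightarrow> k = 2 * j + 3 \<or> even k \<and> 0 < k \<and> k < n \<and> k \<noteq> 2 * j + 2 \<and> k \<noteq> 2 * j + 4" for k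
    by auto
  have remK: "removable n b ?K"
    unfolding removable_def per
  proof (intro conjI allI impI)
    show "?K \<subseteq> {..<n}" using j n by auto
    fix i
    {
      assume "i mod n \<in> ?K"
      moreover have "Suc i mod n = (if Suc (i mod n) = n then 0 else Suc (i mod n))" by (rule mod_Suc)
      ultimately show "Suc i mod n \<notin> ?K" unfolding memK by (auto split: if_splits)
    next
      assume K: "Suc i mod n \<in> ?K"
      let ?p = "i mod n"
      have s: "b (Suc (Suc i)) = b (Suc (Suc ?p))"
        by (metis per mod_Suc_eq)
      have p: "Suc i mod n = Suc ?p" using K unfolding memK mod_Suc[of i] by (auto split: if_splits)
      show "b i \<noteq> b (Suc (Suc i))"
      proof (cases "Suc i mod n = 2 * j + 3")
        case True
        then have "?p = 2 * j + 2" using p by simp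
        then show ?thesis using mid s per[of i] by (simp add: numeral_eq_Suc)
      next
        case False
        then have "Suc i mod n \<in> ?E" using K by blast
        then show ?thesis using rem unfolding removable_def per by blast
      qed
    }
  qed
  \<comment> \<open>Every vertex v >= 2 outside \<open>?K\<close> has a neighbour in
    \<open>?K\<close>. Vertex 0 has the neighbour 2m there unless j + 2 = m, and vertex 1 has the
    neighbour 2 unless j = 0. In these two cases the boundary conditions on j force both neighbours
    of v to have the same colour.\<close>
  have "\<not> removable n b (insert v ?K)" if v: "v < n" "v \<notin> ?K" for v
  proof
    assume r: "removable n b (insert v ?K)"
    have nb: "Suc v mod n \<notin> insert v ?K"
      by (rule removableD(1)[OF r]) (use v in simp)
    have nb': "u \<notin> insert v ?K" if "Suc u mod n = v" "u < n" for u
      using removableD(1)[OF r, of u] that by auto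
    have gd: "b u \<noteq> b (Suc (Suc u))" if "Suc u mod n = v" for u
      using removableD(2)[OF r, of u] that by (simp add: per)
    consider "v = 0" | "v = 1" | "v \<ge> 2" by linarith
    then show False
    proof cases
      case 1
      have "Suc (2 * m) mod n = v" using 1 n by simp
      then have "2 * m \<notin> ?K" "b (2 * m) \<noteq> b (Suc n)"
        using nb'[of "2 * m"] gd[of "2 * m"] n by auto
      then have jm: "j + 2 = m" using j m n unfolding memK by auto
      have e: "2 * m = Suc (2 * m - 1)" using m by simp
      have "b (2 * m) = b 1"
        by (rule third_colour[OF ran ran ran ran, of "2*m-1" 0])
          (use ne[of "2 * m - 1"] ne[of "2 * m"] ne[of 0] j(4)[OF jm] good[of "2 * m - 1" "2 * m + 1"] e bn n m in auto)
      then show False using \<open>b (2 * m) \<noteq> b (Suc n)\<close> bn by simp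
    next
      case 2
      have "Suc 1 mod n = 2" using n m by simp
      then have "2 \<notin> ?K" using nb 2 by simp
      then have j0: "j = 0" using n m unfolding memK by auto
      have "b 0 \<noteq> b 2" using gd[of 0] 2 n m by (simp add: numeral_eq_Suc)
      moreover have "b 2 = b 0"
        by (rule third_colour[OF ran ran ran ran, of 1 3])
          (use ne[of 0] ne[of 1] ne[of 2] j(3)[OF j0] good[of 1 3] n m in \<open>auto simp: numeral_eq_Suc\<close>)
      ultimately show False by simp
    next
      case 3
      then obtain u where u: "v = Suc u" "u \<ge> 1" by (cases v) auto
      have "u \<notin> ?K" using nb'[of u] u v by simp
      moreover have "Suc v \<notin> ?K" if "Suc v < n" using nb that by simp
      ultimately show False using v u n j(1) unfolding memK
        by (cases "Suc v < n") (simp_all, presburger+)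
    qed
  qed
  then show ?thesis using remK cK unfolding maximal_removable_def by blast
qed

text \<open>Brings a maximal set found after normalising by a rotation back to the original
  colouring.\<close>

lemma maximal_removable_rotate:
  assumes a: "a < n" and I: "I \<subseteq> {..<n}"
    and max: "maximal_removable n (\<lambda>i. c ((i + a) mod n)) {k. k < n \<and> (k + a) mod n \<in> I}"
  shows "maximal_removable n c I"
proof -
  have "\<not> removable n c (insert v I)" if v: "v < n" "v \<notin> I" for v
  proof
    assume "removable n c (insert v I)"
    then have r: "removable n (\<lambda>i. c ((i + a) mod n)) {k. k < n \<and> (k + a) mod n \<in> insert v I}"
      using a by (intro removable_rotate) auto
    let ?u = "(v + (n - a)) mod n"
    have u: "(?u + a) mod n = v" using rotate_back(1)[OF a, of v] v by simp
    have "removable n (\<lambda>i. c ((i + a) mod n)) (insert ?u {k. k < n \<and> (k + a) mod n \<in> I})"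
      by (rule removable_subset[OF r]) (use u a in auto)
    moreover have "?u < n" "?u \<notin> {k. k < n \<and> (k + a) mod n \<in> I}" using u v a by simp_all
    ultimately show False using max unfolding maximal_removable_def by blast
  qed
  then show ?thesis
    using max removable_rotate_iff[OF a I] unfolding maximal_removable_def by blast
qed

lemma small_maximal_removable:
  assumes n: "n = 2 * m + 1" and m: "even m" "m \<ge> 2"
    and c: "c \<in> proper_colorings (cycle_graph n) 3"
    and I: "removable n c I" "card I = m"
  shows "\<exists>J. maximal_removable n c J \<and> card J = m - 1"
proof -
  have sub: "I \<subseteq> {..<n}" using I by (simp add: removable_def)
  obtain a where a: "a < n" "{k. k < n \<and> (k + a) mod n \<in> I} = {k. even k \<and> 0 < k \<and> k < n}"
    using large_independent[OF n _ sub I(2) removableD(1)[OF I(1)]] m by auto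
  \<comment> \<open>Defined on all naturals and periodic, as \<open>exchange\<close> requires,
    unlike the extensional \<open>c\<close>.\<close>
  define b where "b = (\<lambda>i. c ((i + a) mod n))"
  have pos: "0 < n" using n by simp
  have "\<exists>K. maximal_removable n b K \<and> card K = m - 1"
  proof (rule exchange[OF n m])
    show "b (i mod n) = b i" for i by (simp add: b_def mod_add_left_eq)
    show "b i \<in> {1..3}" for i
      using c pos by (auto simp: b_def proper_colorings_cycle PiE_iff)
    show "b i \<noteq> b (Suc i)" for i using c pos by (simp add: b_def proper_colorings_cycle)
    show "removable n b {k. even k \<and> 0 < k \<and> k < n}"
      using removable_rotate[OF I(1) pos, of a] by (simp add: a b_def)
  qed
  then obtain K where K: "maximal_removable n b K" "card K = m - 1" by blast
  have Kn: "K \<subseteq> {..<n}" using K by (simp add: maximal_removable_def removable_def)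
  let ?J = "{i. i < n \<and> (i + (n - a)) mod n \<in> K}"
  have J: "{k. k < n \<and> (k + a) mod n \<in> ?J} = K"
  proof -
    have "((k + a) mod n + (n - a)) mod n \<in> K \<longleftrightarrow> k \<in> K" if "k < n" for k
      using that rotate_back(2)[OF a(1), of k] by simp
    then show ?thesis using Kn pos by auto
  qed
  have "?J \<subseteq> {..<n}" by auto
  from card_rotate[OF a(1) this] have "card ?J = card K" unfolding J by simp
  moreover have "maximal_removable n c ?J"
    by (rule maximal_removable_rotate[OF a(1)]) (use K J in \<open>auto simp: b_def\<close>)
  ultimately show ?thesis using K by auto
qed

section \<open>Lower bounds valid for every colouring\<close>

lemma card_critical_le_lcs:
  assumes "finite (verts G)" "critical_set G c X"
  shows "card X \<le> lcs G c"
  unfolding lcs_def using assms by (intro Max_ge finite_critical_cards) auto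

lemma lcs_le:
  assumes "finite (verts G)" "\<And>X. critical_set G c X \<Longrightarrow> card X \<le> b"
  shows "lcs G c \<le> b"
  unfolding lcs_def
  using assms finite_critical_cards[OF assms(1)] critical_set_exists[OF assms(1), of c]
  by (subst Max_le_iff) auto

lemma lcs_cycle_ge:
  assumes n: "n = 2 * m + 1" "m \<ge> 1" and chi: "chromatic_number (cycle_graph n) = 3"
    and c: "c \<in> proper_colorings (cycle_graph n) 3"
  shows "m + 1 \<le> lcs (cycle_graph n) c" and "even m \<Longrightarrow> m + 2 \<le> lcs (cycle_graph n) c"
proof -
  have n3: "n \<ge> 3" using n by simp
  note crit = critical_iff_maximal_removable[OF n3 chi c]
  have ge: "n - card I \<le> lcs (cycle_graph n) c" if "maximal_removable n c I" for I
  proof -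
    have "I \<subseteq> {..<n}" using that by (simp add: maximal_removable_def removable_def)
    then have "{..<n} - ({..<n} - I) = I" "card ({..<n} - I) = n - card I"
      by (auto simp: card_Diff_subset finite_subset)
    moreover from this have "critical_set (cycle_graph n) c ({..<n} - I)"
      using that by (simp add: crit)
    ultimately show ?thesis using card_critical_le_lcs[of "cycle_graph n" c "{..<n} - I"] by simp
  qed
  obtain X where "critical_set (cycle_graph n) c X"
    using critical_set_exists[of "cycle_graph n" c] by auto
  then obtain I where I: "maximal_removable n c I" by (auto simp: crit)
  then have rem: "removable n c I" by (simp add: maximal_removable_def)
  have "2 * card I \<le> n"
    by (rule card_independent(2)) (use n3 rem removableD(1)[OF rem] in \<open>auto simp: removable_def\<close>)
  then have le: "card I \<le> m" using n by simp
  then show "m + 1 \<le> lcs (cycle_graph n) c" using ge[OF I] n by simp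
  show "m + 2 \<le> lcs (cycle_graph n) c" if m: "even m"
  \<comment> \<open>A set of size m is traded for a maximal one of size m - 1; a smaller
    \<open>I\<close> already has a complement of size at least m + 2.\<close>
  proof (cases "card I = m")
    case True
    have "m \<ge> 2" using m n by (auto elim!: evenE)
    then obtain J where "maximal_removable n c J" "card J = m - 1"
      using small_maximal_removable[OF n(1) m _ c rem True] by blast
    then show ?thesis using ge[of J] n by simp
  next
    case False
    then show ?thesis using ge[OF I] n le by simp
  qed
qed

section \<open>The extremal colouring and the chromatic number\<close>

text \<open>In steps \<open>\<plusminus>1\<close> modulo 3 this colouring reads \<open>++++-\<close> followed by blocks \<open>++--\<close> if
  \<open>n mod 4 = 1\<close>, and \<open>+++++--\<close> followed by blocks \<open>++--\<close> if \<open>n mod 4 = 3\<close>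
  and \<open>n > 3\<close>. Each run of length two
  forces the vertex in its middle into every maximal removable set.\<close>

definition extremal_coloring :: "nat \<Rightarrow> nat \<Rightarrow> nat" where
  "extremal_coloring n i =
     (if i \<ge> n then undefined
      else if i = 0 \<or> i = 3 then 1
      else if i = 1 then 2
      else if i = 2 then 3
      else if even i then 2
      else if i mod 4 = n mod 4 then 1 else 3)"

lemma extremal_coloring_proper:
  assumes "odd n" "n \<ge> 3"
  shows "extremal_coloring n \<in> proper_colorings (cycle_graph n) 3"
proof -
  let ?c = "extremal_coloring n"
  have "?c (i mod n) \<noteq> ?c (Suc i mod n)" for i
  proof -
    have "i mod n < n" using assms by simp
    moreover have "Suc i mod n = (if Suc (i mod n) = n then 0 else Suc (i mod n))" by (rule mod_Suc)
    moreover have "?c p \<noteq> ?c (if Suc p = n then 0 else Suc p)" if "p < n" for p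
    proof (cases "Suc p = n")
      case True
      \<comment> \<open>The closing edge runs from n - 1, coloured 3 if n = 3 and 2 otherwise, to
        vertex 0, coloured 1.\<close>
      then have "even p" "p \<ge> 2" using assms by auto
      then show ?thesis using True by (auto simp: extremal_coloring_def)
    next
      case False
      then have "Suc p < n" using that by simp
      then show ?thesis by (auto simp: extremal_coloring_def)
    qed
    ultimately show ?thesis by metis
  qed
  then show ?thesis
    using assms by (auto simp: proper_colorings_cycle PiE_iff extensional_def extremal_coloring_def)
qed

lemma chromatic_number_odd_cycle:
  assumes "odd n" "n \<ge> 3"
  shows "chromatic_number (cycle_graph n) = 3"
  unfolding chromatic_number_def
proof (rule Least_equality)
  show "proper_colorings (cycle_graph n) 3 \<noteq> {}" using extremal_coloring_proper[OF assms] by blast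
next
  fix k assume "proper_colorings (cycle_graph n) k \<noteq> {}"
  then obtain c where "c \<in> proper_colorings (cycle_graph n) k" by blast
  then have c: "c \<in> {..<n} \<rightarrow>\<^sub>E {1..k}" "\<And>i. c (i mod n) \<noteq> c (Suc i mod n)"
    using assms by (simp_all add: proper_colorings_cycle)
  show "3 \<le> k"
  proof (rule ccontr)
    assume "\<not> 3 \<le> k"
    then have two: "c i = 1 \<or> c i = 2" if "i < n" for i
      using PiE_mem[OF c(1), of i] that by auto
    \<comment> \<open>Two colours must alternate along the path from 0, so the closing edge of an
      odd cycle would get equal ends.\<close>
    have "c i = c 0 \<longleftrightarrow> even i" if "i < n" for i
      using that
    proof (induction i)
      case (Suc i)
      then show ?case using c(2)[of i] two[of i] two[of "Suc i"] two[of 0] by auto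
    qed simp
    then have "c (n - 1) = c 0" using assms by simp
    then show False using c(2)[of "n - 1"] assms by simp
  qed
qed

section \<open>Maximal removable sets of the extremal colouring\<close>

text \<open>If all three vertices were missing, the middle one could be added, since its neighbours
  have different colours.\<close>

lemma maximal_removable_dominates:
  assumes n: "n \<ge> 2" and max: "maximal_removable n c I" and p: "c (p mod n) \<noteq> c (Suc (Suc p) mod n)"
  shows "p mod n \<in> I \<or> Suc p mod n \<in> I \<or> Suc (Suc p) mod n \<in> I"
proof (rule ccontr)
  assume neg: "\<not> ?thesis"
  have rem: "removable n c I" using max by (simp add: maximal_removable_def)
  have "removable n c (insert (Suc p mod n) I)"
    unfolding removable_def
  proof (intro conjI allI impI)
    show "insert (Suc p mod n) I \<subseteq> {..<n}" using rem n by (auto simp: removable_def)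
    fix i
    {
      assume "i mod n \<in> insert (Suc p mod n) I"
      then consider "i mod n = Suc p mod n" | "i mod n \<in> I" by blast
      then show "Suc i mod n \<notin> insert (Suc p mod n) I"
      proof cases
        case 1
        then have "Suc i mod n = Suc (Suc p) mod n" by (simp add: Suc_mod_cancel)
        then show ?thesis using neg Suc_mod_neq[of n "Suc p"] n by simp
      next
        case 2
        then have "i mod n \<noteq> p mod n" using neg by metis
        then show ?thesis using removableD(1)[OF rem 2] by (simp add: Suc_mod_cancel)
      qed
    next
      assume "Suc i mod n \<in> insert (Suc p mod n) I"
      then consider "i mod n = p mod n" | "Suc i mod n \<in> I" by (auto simp: Suc_mod_cancel)
      then show "c (i mod n) \<noteq> c (Suc (Suc i) mod n)"
      proof cases
        case 1
        then have "Suc (Suc i) mod n = Suc (Suc p) mod n" by (simp add: Suc_mod_cancel)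
        then show ?thesis using p 1 by simp
      next
        case 2
        then show ?thesis by (rule removableD(2)[OF rem])
      qed
    }
  qed
  then show False using max neg n unfolding maximal_removable_def by simp
qed

text \<open>The even vertices from 6 on supply m - 2 forced elements, and domination of triples
  among the vertices 0 to 5 supplies the rest: one element for even m and for m = 1, two for odd m
  >= 3.\<close>

lemma maximal_removable_extremal:
  assumes n: "n = 2 * m + 1" "m \<ge> 1" and max: "maximal_removable n (extremal_coloring n) I"
  shows "m \<le> card I + (if even m then 1 else 0)"
proof -
  let ?c = "extremal_coloring n"
  have rem: "removable n ?c I" using max by (simp add: maximal_removable_def)
  have fin: "finite I" using rem finite_subset by (auto simp: removable_def)
  have dom: "p \<in> I \<or> Suc p \<in> I \<or> Suc (Suc p) \<in> I"
    if "?c p \<noteq> ?c (Suc (Suc p))" "Suc (Suc p) < n" for p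
    using maximal_removable_dominates[OF _ max, of p] that by simp
  let ?E = "{k. even k \<and> 6 \<le> k \<and> k < n}"
  have E: "?E \<subseteq> I"
  proof
    fix k assume "k \<in> ?E"
    then obtain p where k: "k = Suc p" "odd p" "p \<ge> 5" "Suc p < n" by (cases k) auto
    \<comment> \<open>Both odd neighbours of k are excluded because they see colour 2 on both sides;
      when k = n - 1 the upper one is vertex 0, between k and vertex 1. Their own colours differ, so
      domination leaves only k.\<close>
    have "p \<notin> I"
    proof
      assume "p \<in> I"
      obtain q where q: "p = Suc q" using k by (cases p) auto
      then have "?c q \<noteq> ?c (Suc p)" using removableD(2)[OF rem, of q] \<open>p \<in> I\<close> k by simp
      then show False using k q by (auto simp: extremal_coloring_def)
    qed
    moreover have "Suc (Suc p) mod n \<notin> I"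
    proof
      assume "Suc (Suc p) mod n \<in> I"
      then have ne: "?c (Suc p) \<noteq> ?c (Suc (Suc (Suc p)) mod n)" using removableD(2)[OF rem, of "Suc p"] k by simp
      have "?c (Suc p) = 2" using k by (auto simp: extremal_coloring_def)
      moreover have "?c (Suc (Suc (Suc p)) mod n) = 2"
      proof (cases "Suc (Suc p) = n")
        case True
        then have "Suc (Suc (Suc p)) mod n = 1" using k by (simp add: mod_Suc)
        then show ?thesis using k by (simp add: extremal_coloring_def)
      next
        case False
        then have "Suc (Suc (Suc p)) < n" using k n by presburger
        then show ?thesis using k by (auto simp: extremal_coloring_def)
      qed
      ultimately show False using ne by simp
    qed
    moreover have "?c (p mod n) \<noteq> ?c (Suc (Suc p) mod n)"
    proof (cases "Suc (Suc p) = n")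
      case True
      then have "p mod 4 \<noteq> n mod 4" by presburger
      then show ?thesis using k True by (auto simp: extremal_coloring_def)
    next
      case False
      then have "Suc (Suc p) < n" using k by simp
      moreover have "?c q = (if q mod 4 = n mod 4 then 1 else 3)" if "odd q" "q \<ge> 5" "q < n" for q
        using that by (auto simp: extremal_coloring_def)
      ultimately have c: "?c p = (if p mod 4 = n mod 4 then 1 else 3)"
        "?c (Suc (Suc p)) = (if Suc (Suc p) mod 4 = n mod 4 then 1 else 3)"
        using k by simp_all
      have odd4: "q mod 4 = 1 \<or> q mod 4 = 3" if "odd q" for q :: nat using that by presburger
      have "Suc (Suc p) mod 4 = (if p mod 4 = 1 then 3 else 1)"
        using odd4[OF k(2)] by (auto simp: mod_Suc)
      moreover have "odd n" using n by simp
      moreover have "z = y \<longleftrightarrow> x \<noteq> y"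
        if "z = (if x = 1 then 3 else 1)" "x = 1 \<or> x = 3" "y = 1 \<or> y = 3" for x y z :: nat
        using that by presburger
      ultimately have alt: "Suc (Suc p) mod 4 = n mod 4 \<longleftrightarrow> p mod 4 \<noteq> n mod 4"
        using odd4[OF k(2)] odd4[of n] by blast
      have "?c p \<noteq> ?c (Suc (Suc p))" unfolding c alt by simp
      then show ?thesis using \<open>Suc (Suc p) < n\<close> by simp
    qed
    ultimately show "k \<in> I" using maximal_removable_dominates[OF _ max, of p] k by auto
  qed
  have cE: "card ?E = m - 2"
  proof -
    have "?E = (\<lambda>i. 2 * i + 6) ` {..<m - 2}"
    proof (intro subset_antisym subsetI)
      fix k assume "k \<in> ?E"
      then obtain i where "k = 2 * i" "3 \<le> i" "2 * i < n" by (auto elim!: evenE)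
      then show "k \<in> (\<lambda>i. 2 * i + 6) ` {..<m - 2}" using n by (intro image_eqI[of _ _ "i - 3"]) auto
    qed (use n in auto)
    then show ?thesis by (simp add: card_image inj_on_def)
  qed
  have finE: "finite ?E" by simp
  show ?thesis
  proof (cases "even m")
    case True
    then have m: "m \<ge> 2" using n by (auto elim!: evenE)
    then have "?c 1 \<noteq> ?c 3" using n by (simp add: extremal_coloring_def)
    then obtain x where x: "x \<in> I" "x \<le> 3"
      using dom[of 1] n m by (auto simp: numeral_eq_Suc)
    have "card (insert x ?E) \<le> card I" by (rule card_mono[OF fin]) (use E x in auto)
    moreover have "card (insert x ?E) = Suc (m - 2)"
      using x cE finE by (subst card_insert_disjoint) auto
    ultimately show ?thesis using True m by simp
  next
    case False
    have "?c 0 \<noteq> ?c 2" using n by (simp add: extremal_coloring_def)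
    then obtain x where x: "x \<in> I" "x \<le> 2"
      using dom[of 0] n by (auto simp: numeral_eq_Suc)
    show ?thesis
    proof (cases "m = 1")
      case True
      have "card {x} \<le> card I" by (rule card_mono[OF fin]) (use x in auto)
      then show ?thesis using True by simp
    next
      case m1: False
      then have m: "m \<ge> 3" using False n by presburger
      \<comment> \<open>For odd m, n is 3 modulo 4, so vertex 5 has colour 3 and the triple 3, 4, 5
        must meet \<open>I\<close> as well. It is disjoint from 0, 1, 2, so a second element is
        gained.\<close>
      have "5 mod 4 \<noteq> n mod 4" using False n by presburger
      then have "?c 3 \<noteq> ?c 5" using n m by (simp add: extremal_coloring_def)
      then obtain y where y: "y \<in> I" "3 \<le> y" "y \<le> 5"
        using dom[of 3] n m by (auto simp: numeral_eq_Suc)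
      have "card (insert x (insert y ?E)) \<le> card I" by (rule card_mono[OF fin]) (use E x y in auto)
      moreover have "card (insert x (insert y ?E)) = Suc (Suc (m - 2))"
        using x y cE finE by simp
      ultimately show ?thesis using m by simp
    qed
  qed
qed

section \<open>The value of \<open>lcs_lower\<close>\<close>

lemma lcs_extremal_le:
  assumes n: "n = 2 * m + 1" "m \<ge> 1"
  shows "lcs (cycle_graph n) (extremal_coloring n) \<le> m + (if even m then 2 else 1)"
proof (rule lcs_le)
  fix X assume X: "critical_set (cycle_graph n) (extremal_coloring n) X"
  have n3: "odd n" "n \<ge> 3" using n by auto
  have *: "X \<subseteq> {..<n}" "maximal_removable n (extremal_coloring n) ({..<n} - X)"
    using X critical_iff_maximal_removable[OF n3(2) chromatic_number_odd_cycle[OF n3] extremal_coloring_proper[OF n3]]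
    by auto
  then have "card ({..<n} - X) = n - card X" "card X \<le> n"
    using card_mono[of "{..<n}" X] by (auto simp: card_Diff_subset finite_subset)
  then show "card X \<le> m + (if even m then 2 else 1)"
    using maximal_removable_extremal[OF n *(2)] n by (auto split: if_splits)
qed simp

lemma lcs_lower_odd_cycle:
  assumes n: "n = 2 * m + 1" "m \<ge> 1"
  shows "lcs_lower (cycle_graph n) = m + (if even m then 2 else 1)"
proof -
  have n3: "odd n" "n \<ge> 3" using n by auto
  note chi = chromatic_number_odd_cycle[OF n3] and ext = extremal_coloring_proper[OF n3]
  let ?A = "{lcs (cycle_graph n) c | c. c \<in> proper_colorings (cycle_graph n) 3}"
  have ge: "m + (if even m then 2 else 1) \<le> lcs (cycle_graph n) c"
    if "c \<in> proper_colorings (cycle_graph n) 3" for c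
    using lcs_cycle_ge[OF n chi that] by simp
  have "Min ?A = m + (if even m then 2 else 1)"
  proof (rule Min_eqI)
    show "finite ?A" using finite_proper_colorings[of "cycle_graph n" 3] by simp
    show "m + (if even m then 2 else 1) \<le> y" if "y \<in> ?A" for y using that ge by blast
    have "lcs (cycle_graph n) (extremal_coloring n) \<in> ?A" using ext by blast
    moreover have "lcs (cycle_graph n) (extremal_coloring n) = m + (if even m then 2 else 1)"
      using lcs_extremal_le[OF n] ge[OF ext] by (rule antisym)
    ultimately show "m + (if even m then 2 else 1) \<in> ?A" by simp
  qed
  then show ?thesis unfolding lcs_lower_def chi .
qed

theorem theorem10:
  fixes n :: nat
  assumes "odd n" and "n \<ge> 3"
  shows "(n mod 4 = 1 \<longrightarrow> real (lcs_lower (cycle_graph n)) = (real n + 3) / 2) \<and>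
         (n mod 4 = 3 \<longrightarrow> real (lcs_lower (cycle_graph n)) = (real n + 1) / 2)"
proof -
  obtain m where n: "n = 2 * m + 1" "m \<ge> 1" using assms by (auto elim!: oddE)
  have "even m \<longleftrightarrow> n mod 4 = 1" "n mod 4 = 1 \<or> n mod 4 = 3" using n by presburger+
  then show ?thesis using lcs_lower_odd_cycle[OF n] n(1) by auto
qed

end
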